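(* Let $(\Omega,d,\mu)$ be a metric probability space, let $1\leq q_0<q<\infty$, and set $p_0=q_0^*$, $p=q^*$. Then for all $0<a<b<1$: $$ \frac{1}{Cap_q(a,b)} \leq \gamma_{p,p_0}\left(\int_a^b \frac{ds}{(s-a)^{p/p_0}\,Cap_{q_0}^p(s,b)}\right)^{1/p}, $$ where $$ \gamma_{p,p_0} := \frac{(\frac{p_0}{p}-1)^{1/p_0}}{(1-\frac{p}{p_0})^{1/p}}. $$ (When $q_0=1$, so $p_0=\infty$, one has $p/p_0=0$ and $\gamma_{p,p_0}$ is understood as its limiting value $1$.)
   Context: $(\Omega,d)$ is a separable metric space and $\mu$ is a Borel probability measure on it which is not a unit mass at a point. A function is Lipschitz-on-balls if it is Lipschitz on every ball of $(\Omega,d)$; for such $\Phi$, $|\nabla\Phi|(x):=\limsup_{d(y,x)\to 0+}\frac{|\Phi(y)-\Phi(x)|}{d(x,y)}$ (and $0$ if $x$ is an isolated point). For $1\leq q<\infty$ and $0<a\leq b<1$, the $q$-capacity profile of $(\Omega,d,\mu)$ is $$ Cap_q(a,b) := \inf\left\{ \|\,|\nabla\Phi|\,\|_{L_q(\mu)} : \mu\{\Phi=1\}\geq a,\ \mu\{\Phi=0\}\geq 1-b \right\}, $$ where the infimum is over all $\Phi:\Omega\to[0,1]$ which are Lipschitz-on-balls. $Cap_{q_0}^p(s,b)$ means $(Cap_{q_0}(s,b))^p$. The conjugate exponent of $q\in[1,\infty]$ is $q^*=q/(q-1)$ (with $1^*=\infty$).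
   Formalization: The formal theorem assumes Cap_q(a,b) is not 0; otherwise 1/Cap_q(a,b) is undefined, and read as infinity the claim fails, e.g. for the uniform measure on [0,1/2] and [1,3/2] in R with q_0=1, a=1/2, b=9/10. *)

theory Defs
  imports "HOL-Probability.Probability"
begin

text \<open>
  Gradients, norms and capacities take values in \<open>[0,\<infinity>]\<close>, since the norm of the gradient
  of a function that is Lipschitz on balls may be infinite, and since the infimum defining the
  capacity may range over the empty set (it is then \<open>\<infinity>\<close>).  In \<^typ>\<open>ennreal\<close> one has
  \<open>1 / 0 = \<infinity>\<close> and \<open>1 / \<infinity> = 0\<close>.
\<close>

text \<open>Only used for exponents \<open>r > 0\<close>; then \<open>0\<close> has power \<open>0\<close> and \<open>\<infinity>\<close> has power \<open>\<infinity>\<close>.\<close>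

definition epowr :: "ennreal \<Rightarrow> real \<Rightarrow> ennreal"
  where "epowr x r = (if x = \<infinity> then \<infinity> else ennreal (enn2real x powr r))"

definition conj_exponent :: "ereal \<Rightarrow> ereal"
  where "conj_exponent q = (if q = 1 then \<infinity> else if q = \<infinity> then 1 else q / (q - 1))"

definition metric_probability_space :: "'a::metric_space measure \<Rightarrow> bool"
  where "metric_probability_space \<mu> \<longleftrightarrow>
    separable_space (euclidean :: 'a topology) \<and> sets \<mu> = sets borel \<and> prob_space \<mu> \<and>
    (\<forall>x. \<mu> \<noteq> return borel x)"

definition lipschitz_on_balls :: "('a::metric_space \<Rightarrow> real) \<Rightarrow> bool"
  where "lipschitz_on_balls \<Phi> \<longleftrightarrow> (\<forall>x r. \<exists>L. L-lipschitz_on (ball x r) \<Phi>)"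

text \<open>The filter \<open>at x\<close> excludes \<open>x\<close> itself, so the upper limit is over \<open>dist y x \<rightarrow> 0+\<close>.\<close>

definition gradient_modulus :: "('a::metric_space \<Rightarrow> real) \<Rightarrow> 'a \<Rightarrow> ennreal"
  where "gradient_modulus \<Phi> x =
    (if x islimpt UNIV
     then Limsup (at x) (\<lambda>y. ennreal (\<bar>\<Phi> y - \<Phi> x\<bar> / dist x y))
     else 0)"

definition Lq_norm :: "'a measure \<Rightarrow> real \<Rightarrow> ('a \<Rightarrow> ennreal) \<Rightarrow> ennreal"
  where "Lq_norm \<mu> q f = epowr (\<integral>\<^sup>+x. epowr (f x) q \<partial>\<mu>) (1 / q)"

definition Cap :: "'a::metric_space measure \<Rightarrow> real \<Rightarrow> real \<Rightarrow> real \<Rightarrow> ennreal"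
  where "Cap \<mu> q a b =
    Inf {Lq_norm \<mu> q (gradient_modulus \<Phi>) | \<Phi>.
      range \<Phi> \<subseteq> {0..1} \<and> lipschitz_on_balls \<Phi> \<and>
      measure \<mu> {x \<in> space \<mu>. \<Phi> x = 1} \<ge> a \<and>
      measure \<mu> {x \<in> space \<mu>. \<Phi> x = 0} \<ge> 1 - b}"

text \<open>For \<open>p\<^sub>0 = \<infinity>\<close> the value is the limit as \<open>p\<^sub>0 \<rightarrow> \<infinity>\<close>.\<close>

definition gamma_const :: "ereal \<Rightarrow> ereal \<Rightarrow> real"
  where "gamma_const p p\<^sub>0 =
    (if p\<^sub>0 = \<infinity> then 1
     else (real_of_ereal (p\<^sub>0 / p) - 1) powr real_of_ereal (1 / p\<^sub>0)
            / (1 - real_of_ereal (p / p\<^sub>0)) powr real_of_ereal (1 / p))"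

text \<open>
  Pitfall: with \<open>1 / 0 = \<infinity>\<close>, the comparison of \<open>1 / Cap \<mu> q a b\<close> with
  \<open>gamma_const p p\<^sub>0\<close> times the \<open>p\<close>-th root of the integral of
  \<open>1 / ((s - a) powr (p / p\<^sub>0) * Cap \<mu> q\<^sub>0 s b ^ p)\<close> over \<open>a < s < b\<close> can fail when
  \<open>Cap \<mu> q a b = 0\<close>, so it must be read for \<open>Cap \<mu> q a b \<noteq> 0\<close>.
  For example, let \<open>\<mu>\<close> be the uniform measure on \<open>[0, 1/2] \<union> [1, 3/2]\<close>, regarded as a measure
  on the real line, and let \<open>q\<^sub>0 = 1\<close>, \<open>a = 1/2\<close>, \<open>b = 9/10\<close>.  A Lipschitz function that equals 1
  up to \<open>2/3\<close> and 0 from \<open>5/6\<close> on shows \<open>Cap \<mu> q a b = 0\<close>.  For \<open>a < s < b\<close>, on the other hand,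
  every admissible function takes both values 0 and 1 on one of the two intervals, so that
  \<open>Cap \<mu> 1 s b \<ge> 1\<close> and the integral is at most \<open>b - a\<close>.
\<close>

end

theory Submission
  imports Defs
begin

text \<open>
  Fix an admissible \<open>\<Phi>\<close>, write \<open>g\<close> for its gradient modulus, and read \<open>p\<close> and \<open>p\<^sub>0\<close> as real
  numbers, with \<open>\<alpha> = p / p\<^sub>0\<close> (so \<open>\<alpha> = 0\<close> when \<open>q\<^sub>0 = 1\<close>). The proof cuts \<open>\<Phi>\<close> into countably
  many horizontal strips, tests the \<open>q\<^sub>0\<close>-capacity on each of them, and adds up the results with
  Hoelder's inequality; neither a co-area formula nor a rearrangement is involved.

  If \<open>\<Phi>\<close> is truncated to the levels between \<open>t\<close> and \<open>t'\<close> and rescaled to \<open>[0,1]\<close>, its gradient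
  lives on the strip \<open>t < \<Phi> < t'\<close>. If \<open>\<mu>{\<Phi> \<ge> t'} \<ge> s\<close>, the truncation competes for the capacity at
  \<open>(s, b)\<close>, and therefore \<open>(t' - t) Cap q\<^sub>0 s b\<close> is at most the \<open>L q\<^sub>0\<close> norm of \<open>g\<close> on the strip
  (\<open>strip_capacity\<close>). Hoelder's inequality turns this norm into the \<open>L q\<close> norm, at the price of the
  factor \<open>\<mu>(strip) powr (1/q\<^sub>0 - 1/q)\<close>, and \<open>1/q\<^sub>0 - 1/q = (1 - \<alpha>)/p\<close>.

  For a ratio \<open>0 < \<rho> < 1\<close> let \<open>s\<^sub>i = a + (b - a) \<rho>^i\<close>, and let \<open>t\<^sub>i\<close> be the level with
  \<open>\<mu>{\<Phi> \<ge> t\<^sub>i} \<ge> s\<^sub>i \<ge> \<mu>{\<Phi> > t\<^sub>i}\<close>, beginning with \<open>t\<^sub>0 = 0\<close>. Then the \<open>i\<close>-th open strip has measure at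
  most \<open>s\<^sub>i - s\<^sub>i\<^sub>+\<^sub>1\<close>, and a second use of Hoelder's inequality, for the sum over \<open>i\<close>, bounds
  \<open>sup t\<^sub>i\<close> by the \<open>L q\<close> norm of \<open>g\<close> times the \<open>p\<close>-th root of
  \<open>\<Sum>i. (s\<^sub>i - s\<^sub>i\<^sub>+\<^sub>1) powr (1 - \<alpha>) / (Cap q\<^sub>0 s\<^sub>i\<^sub>+\<^sub>1 b) powr p\<close>.
  By the geometric choice of the \<open>s\<^sub>i\<close> each summand is one and the same constant times the value
  of the integrand \<open>1 / ((s - a) powr \<alpha> * (Cap q\<^sub>0 s b) powr p)\<close> at \<open>s\<^sub>i\<^sub>+\<^sub>1\<close> times the length of
  \<open>(s\<^sub>i\<^sub>+\<^sub>2, s\<^sub>i\<^sub>+\<^sub>1)\<close>. The integrand decreases, so the sum is a lower Riemann sum, up to the constant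
  \<open>1 / (\<rho> powr (1 - \<alpha>) * (1 - \<rho>) powr \<alpha>)\<close>. Finally \<open>sup t\<^sub>i = 1\<close>: otherwise the strip between
  \<open>sup t\<^sub>i\<close> and 1 would be a null set, and truncating to it would give \<open>Cap q a b = 0\<close>
  (\<open>capacity_slicing\<close>).

  The constant is least at \<open>\<rho> = 1 - \<alpha>\<close>, and its \<open>p\<close>-th root there is exactly \<open>\<gamma>\<close>. For \<open>\<alpha> = 0\<close>
  this ratio is 1, which produces no slices, and \<open>\<gamma> = 1\<close> is reached as \<open>\<rho>\<close> tends to 1
  (\<open>slicing_const_near_gamma\<close>).
\<close>

section \<open>Powers in the extended half-line and Hoelder's inequality\<close>

lemma epowr_0 [simp]: "epowr 0 r = 0"
  by (simp add: epowr_def)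

lemma epowr_top [simp]: "epowr \<top> r = \<top>"
  by (simp add: epowr_def)

lemma epowr_1 [simp]: "epowr 1 r = 1"
  by (simp add: epowr_def)

lemma epowr_ennreal: "0 \<le> x \<Longrightarrow> epowr (ennreal x) r = ennreal (x powr r)"
  by (simp add: epowr_def)

lemma epowr_exponent_1 [simp]: "epowr x 1 = x"
  by (cases x) (auto simp: epowr_def)

lemma epowr_mono: "x \<le> y \<Longrightarrow> 0 \<le> r \<Longrightarrow> epowr x r \<le> epowr y r"
  by (cases x; cases y) (auto simp: epowr_ennreal top_unique intro!: ennreal_leI powr_mono2)

lemma epowr_mult:
  assumes "0 < r"
  shows "epowr (x * y) r = epowr x r * epowr y r"
proof (cases x)
  case x: (real u)
  show ?thesis
  proof (cases y)
    case (real v)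
    then show ?thesis using x by (simp add: epowr_ennreal powr_mult flip: ennreal_mult)
  next
    case top
    then show ?thesis using x by (cases "u = 0") (auto simp: epowr_ennreal ennreal_mult_top)
  qed
next
  case x: top
  show ?thesis
  proof (cases y)
    case (real v)
    then show ?thesis using x by (cases "v = 0") (auto simp: epowr_ennreal ennreal_top_mult)
  qed (use x in simp)
qed

lemma epowr_epowr: "epowr (epowr x r) s = epowr x (r * s)"
  by (cases x) (auto simp: epowr_ennreal powr_powr)

lemma epowr_divide:
  assumes "0 < r"
  shows "epowr (1 / x) r = 1 / epowr x r"
proof (cases x)
  case (real u)
  show ?thesis
  proof (cases "u = 0")
    case False
    have "1 / ennreal v = ennreal (1 / v)" if "v > 0" for v
      using that divide_ennreal[of 1 v] by simp
    then show ?thesis using real False by (simp add: epowr_ennreal powr_divide)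
  qed (use real in simp)
qed simp

lemma epowr_eq_0_iff [simp]: "epowr x r = 0 \<longleftrightarrow> x = 0"
  by (cases x) (auto simp: epowr_ennreal)

lemma epowr_eq_top_iff [simp]: "epowr x r = \<top> \<longleftrightarrow> x = \<top>"
  by (cases x) (auto simp: epowr_ennreal)

lemma borel_measurable_epowr [measurable (raw)]:
  assumes [measurable]: "f \<in> borel_measurable M"
  shows "(\<lambda>x. epowr (f x) r) \<in> borel_measurable M"
  unfolding epowr_def by measurable

lemma epowr_indicator: "epowr (x * indicator A y) r = epowr x r * indicator A y"
  by (auto simp: indicator_def)

lemma Lq_norm_cmult:
  assumes "0 < q" and [measurable]: "f \<in> borel_measurable M"
  shows "Lq_norm M q (\<lambda>x. c * f x) = c * Lq_norm M q f"
  using assms(1) unfolding Lq_norm_def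
  by (simp add: epowr_mult nn_integral_cmult epowr_epowr)

lemma Lq_norm_mono:
  assumes "0 < q" and "\<And>x. f x \<le> g x"
  shows "Lq_norm M q f \<le> Lq_norm M q g"
  unfolding Lq_norm_def using assms
  by (intro epowr_mono nn_integral_mono) auto

text \<open>
  After normalising both integrals to 1, this is Young's inequality
  \<open>x powr \<theta> * y powr (1 - \<theta>) \<le> \<theta> x + (1 - \<theta>) y\<close> applied pointwise; the cases in which an integral is 0 or \<open>\<infinity>\<close> have to be treated apart.
\<close>

lemma Holder_nn_integral:
  fixes f h :: "'a \<Rightarrow> ennreal"
  assumes \<theta>: "0 < \<theta>" "\<theta> < 1"
    and [measurable]: "f \<in> borel_measurable M" "h \<in> borel_measurable M"
  shows "(\<integral>\<^sup>+x. epowr (f x) \<theta> * epowr (h x) (1 - \<theta>) \<partial>M)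
    \<le> epowr (\<integral>\<^sup>+x. f x \<partial>M) \<theta> * epowr (\<integral>\<^sup>+x. h x \<partial>M) (1 - \<theta>)"
    (is "?L \<le> epowr ?F \<theta> * epowr ?H (1 - \<theta>)")
proof -
  have null: "?L = 0" if "?F = 0 \<or> ?H = 0"
  proof -
    have "(AE x in M. f x = 0) \<or> (AE x in M. h x = 0)"
      using that by (simp add: nn_integral_0_iff_AE)
    then have "AE x in M. epowr (f x) \<theta> * epowr (h x) (1 - \<theta>) = 0"
      by auto
    then show ?thesis by (simp add: nn_integral_0_iff_AE)
  qed
  consider "?F = 0 \<or> ?H = 0" | "?F \<noteq> 0" "?H \<noteq> 0" "?F = \<top> \<or> ?H = \<top>"
    | "?F \<noteq> 0" "?H \<noteq> 0" "?F \<noteq> \<top>" "?H \<noteq> \<top>" by blast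
  then show ?thesis
  proof cases
    case 1
    then show ?thesis using null by simp
  next
    case 2
    then have "epowr ?F \<theta> * epowr ?H (1 - \<theta>) = \<top>"
      by (auto simp: ennreal_mult_eq_top_iff)
    then show ?thesis by simp
  next
    case 3
    then obtain F H where F: "?F = ennreal F" "0 < F" and H: "?H = ennreal H" "0 < H"
    proof -
      show thesis
        using 3 that by (cases ?F; cases ?H) (auto simp: less_le)
    qed
    let ?c = "F powr \<theta> * H powr (1 - \<theta>)"
    have young: "epowr u \<theta> * epowr v (1 - \<theta>)
        \<le> ennreal (?c * \<theta> / F) * u + ennreal (?c * (1 - \<theta>) / H) * v" for u v
    proof (cases "u = \<top> \<or> v = \<top>")
      case True
      then show ?thesis using F H \<theta> by (auto simp: ennreal_mult_eq_top_iff)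
    next
      case False
      then obtain x y where xy: "u = ennreal x" "0 \<le> x" "v = ennreal y" "0 \<le> y"
        by (cases u; cases v) auto
      have "(x / F) powr \<theta> * (y / H) powr (1 - \<theta>) \<le> \<theta> * (x / F) + (1 - \<theta>) * (y / H)"
        
      proof (cases "x = 0 \<or> y = 0")
        case False
        then show ?thesis using \<theta> xy F H by (intro Youngs_inequality_0) auto
      qed (use \<theta> xy F H in auto)
      then have "?c * ((x / F) powr \<theta> * (y / H) powr (1 - \<theta>))
          \<le> ?c * (\<theta> * (x / F) + (1 - \<theta>) * (y / H))"
        by (intro mult_left_mono) auto
      then have "x powr \<theta> * y powr (1 - \<theta>) \<le> ?c * \<theta> / F * x + ?c * (1 - \<theta>) / H * y"
        using F H xy by (simp add: powr_divide field_simps)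
      then show ?thesis
        using xy F H \<theta> by (simp add: epowr_ennreal flip: ennreal_mult ennreal_plus)
    qed
    have "?L \<le> (\<integral>\<^sup>+x. ennreal (?c * \<theta> / F) * f x + ennreal (?c * (1 - \<theta>) / H) * h x \<partial>M)"
      by (intro nn_integral_mono young)
    also have "\<dots> = ennreal (?c * \<theta> / F) * ennreal F + ennreal (?c * (1 - \<theta>) / H) * ennreal H"
      using F H by (simp add: nn_integral_add nn_integral_cmult)
    also have "\<dots> = ennreal ?c"
      using F H \<theta> by (simp add: field_simps flip: ennreal_mult ennreal_plus)
    also have "\<dots> = epowr ?F \<theta> * epowr ?H (1 - \<theta>)"
      using F H by (simp add: epowr_ennreal flip: ennreal_mult)
    finally show ?thesis .
  qed
qed

lemma Holder_sum:
  fixes f h :: "'i \<Rightarrow> ennreal"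
  assumes "0 < \<theta>" "\<theta> < 1" "finite I"
  shows "(\<Sum>i\<in>I. epowr (f i) \<theta> * epowr (h i) (1 - \<theta>))
    \<le> epowr (\<Sum>i\<in>I. f i) \<theta> * epowr (\<Sum>i\<in>I. h i) (1 - \<theta>)"
  using Holder_nn_integral[OF assms(1,2), of f "count_space I" h] assms(3)
  by (simp add: nn_integral_count_space_finite)

text \<open>
  Serves three limits: the inner levels of a truncation tending to the boundary of a strip, the
  quantile levels tending to 1, and the ratio of the slices tending to 1.
\<close>

lemma ennreal_le_mult_one_interval:
  fixes x y :: ennreal
  assumes "\<And>r. 0 < r \<Longrightarrow> r < 1 \<Longrightarrow> ennreal r * x \<le> y"
  shows "x \<le> y"
proof (cases y)
  case y: (real v)
  show ?thesis
  proof (cases x)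
    case (real u)
    have "u \<le> v"
    proof (rule field_le_mult_one_interval)
      fix r :: real assume "0 < r" "r < 1"
      with assms[of r] show "r * u \<le> v"
        using y real by (simp flip: ennreal_mult)
    qed
    then show ?thesis using y real by simp
  next
    case top
    then show ?thesis using assms[of "1/2"] y by (simp add: ennreal_mult_top top_unique)
  qed
qed simp

lemma ennreal_le_mult_inverseI:
  fixes x y c :: ennreal
  assumes "x * c \<le> y" "c \<noteq> 0" "y \<noteq> \<top>"
  shows "x \<le> y * (1 / c)"
proof (cases "c = \<top>")
  case True
  then have "x = 0" using assms by (auto simp: ennreal_mult_top top_unique split: if_splits)
  then show ?thesis by simp
next
  case False
  then have "x = x * c / c"
    using assms(2) by (simp add: ennreal_mult_divide_eq)
  also have "\<dots> \<le> y / c" using assms(1) by (rule divide_right_mono_ennreal)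
  finally show ?thesis by (simp add: ennreal_times_divide)
qed

lemma one_divide_antimono_ennreal:
  fixes x y :: ennreal
  assumes "x \<le> y"
  shows "1 / y \<le> 1 / x"
proof (cases "x = 0 \<or> y = \<top>")
  case False
  with assms obtain u v where "x = ennreal u" "0 < u" "y = ennreal v" "u \<le> v"
    by (cases x; cases y) (auto simp: less_le top_unique)
  then show ?thesis
    by (simp add: divide_ennreal_def inverse_ennreal ennreal_leI le_imp_inverse_le)
qed auto

lemma sum_indicator_disjoint_le_1:
  assumes "disjoint_family_on A I" "finite I"
  shows "(\<Sum>i\<in>I. indicator (A i) x :: ennreal) \<le> 1"
proof (cases "\<exists>j\<in>I. x \<in> A j")
  case True
  then obtain j where j: "j \<in> I" "x \<in> A j" by blast
  have "x \<notin> A i" if "i \<in> I - {j}" for i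
    using assms(1) that j by (auto simp: disjoint_family_on_def)
  then have "(\<Sum>i\<in>I. indicator (A i) x :: ennreal) = indicator (A j) x"
    using assms(2) j(1) by (simp add: sum.remove)
  then show ?thesis using j by simp
qed (simp add: indicator_def)

section \<open>The gradient modulus and truncation\<close>

text \<open>
  Radii \<open>1 / n\<close> suffice for the upper limit. The formula covers isolated points as well: there the
  supremum is over the empty set for large \<open>n\<close>, and in \<^typ>\<open>ennreal\<close> that supremum is 0.
\<close>

lemma gradient_modulus_INF_SUP:
  "gradient_modulus \<Phi> x =
    (INF n. SUP y\<in>ball x (1 / real (Suc n)) - {x}. ennreal (\<bar>\<Phi> y - \<Phi> x\<bar> / dist x y))"
  (is "_ = (INF n. ?S (1 / real (Suc n)))")
proof (cases "x islimpt UNIV")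
  case True
  have "Limsup (at x) (\<lambda>y. ennreal (\<bar>\<Phi> y - \<Phi> x\<bar> / dist x y)) = (INF e\<in>{0<..}. ?S e)"
    by (simp add: Limsup_at)
  also have "\<dots> = (INF n. ?S (1 / real (Suc n)))"
  proof (rule INF_eq)
    fix e :: real assume "e \<in> {0<..}"
    then obtain n where "1 / real (Suc n) < e"
      using nat_approx_posE[of e] by auto
    then show "\<exists>n\<in>UNIV. ?S (1 / real (Suc n)) \<le> ?S e"
      by (intro bexI[of _ n] SUP_subset_mono) auto
  qed auto
  finally show ?thesis using True by (simp add: gradient_modulus_def)
next
  case False
  then obtain e where e: "e > 0" "\<And>y. y \<noteq> x \<Longrightarrow> \<not> dist y x < e"
    unfolding islimpt_approachable by auto
  obtain n where n: "1 / real (Suc n) < e"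
    using nat_approx_posE[OF e(1)] by auto
  have "ball x (1 / real (Suc n)) - {x} = {}"
  proof -
    have far: False if "y \<noteq> x" "dist x y < 1 / real (Suc n)" for y
      using e(2)[OF that(1)] that(2) n by (simp add: dist_commute[of y x])
    show ?thesis
    proof (rule equals0I)
      fix y assume "y \<in> ball x (1 / real (Suc n)) - {x}"
      then show False using far[of y] by simp
    qed
  qed
  then have "?S (1 / real (Suc n)) = 0"
    by (simp only: SUP_empty bot_ennreal)
  then have "(INF n. ?S (1 / real (Suc n))) \<le> 0"
    using INF_lower[of n UNIV "\<lambda>n. ?S (1 / real (Suc n))"] by simp
  then show ?thesis using False by (simp add: gradient_modulus_def)
qed

text \<open>
  At a fixed radius the supremum of the difference quotients is lower semicontinuous: a point \<open>y\<close>
  whose quotient with \<open>x\<close> exceeds \<open>c\<close> still does so for all \<open>x'\<close> near \<open>x\<close>.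
\<close>

lemma borel_measurable_gradient_modulus:
  fixes \<Phi> :: "'a::metric_space \<Rightarrow> real"
  assumes "continuous_on UNIV \<Phi>"
  shows "gradient_modulus \<Phi> \<in> borel_measurable borel"
proof -
  have "(\<lambda>x. SUP y\<in>ball x r - {x}. ennreal (\<bar>\<Phi> y - \<Phi> x\<bar> / dist x y)) \<in> borel_measurable borel"
    for r
  proof (rule borel_measurableI_greater)
    fix c :: ennreal
    have "{x \<in> space borel. c < (SUP y\<in>ball x r - {x}. ennreal (\<bar>\<Phi> y - \<Phi> x\<bar> / dist x y))}
        = (\<Union>y. {x \<in> ball y r - {y}. c < ennreal (\<bar>\<Phi> y - \<Phi> x\<bar> / dist x y)})"
      by (auto simp: less_SUP_iff dist_commute)
    moreover have "open {x \<in> ball y r - {y}. c < ennreal (\<bar>\<Phi> y - \<Phi> x\<bar> / dist x y)}" for y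
    proof -
      have "continuous_on (ball y r - {y}) (\<lambda>x. ennreal (\<bar>\<Phi> y - \<Phi> x\<bar> / dist x y))"
        by (intro continuous_on_ennreal continuous_intros continuous_on_subset[OF assms]) auto
      then have "open ((\<lambda>x. ennreal (\<bar>\<Phi> y - \<Phi> x\<bar> / dist x y)) -` {c<..} \<inter> (ball y r - {y}))"
        using continuous_on_open_vimage[OF open_delete[OF open_ball]] open_greaterThan by blast
      moreover have "(\<lambda>x. ennreal (\<bar>\<Phi> y - \<Phi> x\<bar> / dist x y)) -` {c<..} \<inter> (ball y r - {y})
          = {x \<in> ball y r - {y}. c < ennreal (\<bar>\<Phi> y - \<Phi> x\<bar> / dist x y)}" by blast
      ultimately show ?thesis by simp
    qed
    ultimately show "{x \<in> space borel. c < (SUP y\<in>ball x r - {x}.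
        ennreal (\<bar>\<Phi> y - \<Phi> x\<bar> / dist x y))} \<in> sets borel"
      by (simp only:) (intro borel_open open_UN ballI)
  qed
  then show ?thesis
    unfolding gradient_modulus_INF_SUP[abs_def] by (intro borel_measurable_INF) auto
qed

definition rescaled_truncation :: "real \<Rightarrow> real \<Rightarrow> real \<Rightarrow> real"
  where "rescaled_truncation u v t = max 0 (min 1 ((t - u) / (v - u)))"

lemma rescaled_truncation_range: "rescaled_truncation u v t \<in> {0..1}"
  by (auto simp: rescaled_truncation_def)

lemma rescaled_truncation_eq_0: "u < v \<Longrightarrow> t \<le> u \<Longrightarrow> rescaled_truncation u v t = 0"
  using divide_nonpos_pos[of "t - u" "v - u"] by (simp add: rescaled_truncation_def)

lemma rescaled_truncation_eq_1: "u < v \<Longrightarrow> v \<le> t \<Longrightarrow> rescaled_truncation u v t = 1"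
  by (auto simp: rescaled_truncation_def min_def max_def field_simps)

lemma rescaled_truncation_lipschitz:
  assumes "u < v"
  shows "\<bar>rescaled_truncation u v s - rescaled_truncation u v t\<bar> \<le> \<bar>s - t\<bar> / (v - u)"
proof -
  have "\<bar>max 0 (min 1 x) - max 0 (min 1 y)\<bar> \<le> \<bar>x - y\<bar>" for x y :: real
    by (auto simp: max_def min_def)
  from this[of "(s - u) / (v - u)" "(t - u) / (v - u)"] show ?thesis
    using assms by (simp add: rescaled_truncation_def flip: diff_divide_distrib)
qed

lemma borel_measurable_rescaled_truncation [measurable]:
  "rescaled_truncation u v \<in> borel_measurable borel"
  unfolding rescaled_truncation_def[abs_def] by measurable

lemma lipschitz_on_balls_rescaled_truncation:
  assumes "lipschitz_on_balls \<Phi>" "u < v"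
  shows "lipschitz_on_balls (\<lambda>x. rescaled_truncation u v (\<Phi> x))"
  unfolding lipschitz_on_balls_def
proof (intro allI)
  fix x r
  obtain L where L: "L-lipschitz_on (ball x r) \<Phi>"
    using assms(1) by (auto simp: lipschitz_on_balls_def)
  have "(1 / (v - u))-lipschitz_on (\<Phi> ` ball x r) (rescaled_truncation u v)"
    using rescaled_truncation_lipschitz[OF assms(2)] assms(2)
    by (intro lipschitz_onI) (auto simp: dist_real_def)
  from lipschitz_on_compose2[OF L this]
  show "\<exists>L. L-lipschitz_on (ball x r) (\<lambda>x. rescaled_truncation u v (\<Phi> x))"
    by (auto simp: o_def)
qed

lemma lipschitz_on_balls_imp_continuous:
  assumes "lipschitz_on_balls \<Phi>"
  shows "continuous_on UNIV \<Phi>"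
proof -
  have "isCont \<Phi> x" for x
  proof -
    obtain L where "L-lipschitz_on (ball x 1) \<Phi>"
      using assms by (auto simp: lipschitz_on_balls_def)
    then have "continuous_on (ball x 1) \<Phi>" by (rule lipschitz_on_continuous_on)
    then show ?thesis
      by (simp add: continuous_on_eq_continuous_at)
  qed
  then show ?thesis by (simp add: continuous_at_imp_continuous_on)
qed

text \<open>
  Off the closed strip the truncation is locally constant. On the two boundary levels its gradient
  need not vanish, not even almost everywhere, since these level sets may have positive measure.
\<close>

lemma gradient_modulus_rescaled_truncation:
  assumes "continuous_on UNIV \<Phi>" "u < v"
  shows "gradient_modulus (\<lambda>x. rescaled_truncation u v (\<Phi> x)) x
    \<le> ennreal (1 / (v - u)) * (gradient_modulus \<Phi> x * indicator {x. u \<le> \<Phi> x \<and> \<Phi> x \<le> v} x)"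
proof (cases "x islimpt UNIV")
  case lim: True
  then have nontriv: "at x \<noteq> bot" by (simp add: trivial_limit_within)
  let ?T = "\<lambda>x. rescaled_truncation u v (\<Phi> x)"
  show ?thesis
  proof (cases "u \<le> \<Phi> x \<and> \<Phi> x \<le> v")
    case True
    have "Limsup (at x) (\<lambda>y. ennreal (\<bar>?T y - ?T x\<bar> / dist x y))
        \<le> Limsup (at x) (\<lambda>y. ennreal (1 / (v - u)) * ennreal (\<bar>\<Phi> y - \<Phi> x\<bar> / dist x y))"
    proof (intro Limsup_mono always_eventually allI)
      fix y
      have "\<bar>?T y - ?T x\<bar> / dist x y \<le> (\<bar>\<Phi> y - \<Phi> x\<bar> / (v - u)) / dist x y"
        using rescaled_truncation_lipschitz[OF assms(2)] by (intro divide_right_mono) auto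
      also have "\<dots> = 1 / (v - u) * (\<bar>\<Phi> y - \<Phi> x\<bar> / dist x y)" by simp
      finally show "ennreal (\<bar>?T y - ?T x\<bar> / dist x y)
          \<le> ennreal (1 / (v - u)) * ennreal (\<bar>\<Phi> y - \<Phi> x\<bar> / dist x y)"
        using assms(2) by (subst ennreal_mult[symmetric]) (auto intro!: ennreal_leI)
    qed
    also have "\<dots> = ennreal (1 / (v - u)) * Limsup (at x) (\<lambda>y. ennreal (\<bar>\<Phi> y - \<Phi> x\<bar> / dist x y))"
      using nontriv
      by (intro Limsup_compose_continuous_mono[where f="\<lambda>z. ennreal (1 / (v - u)) * z"])
        (auto intro!: monoI mult_left_mono ennreal_continuous_on_cmult[OF _ continuous_on_id])
    finally show ?thesis using True lim by (simp add: gradient_modulus_def)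
  next
    case False
    have "\<forall>\<^sub>F y in at x. ?T y = ?T x"
    proof -
      have t: "(\<Phi> \<longlongrightarrow> \<Phi> x) (at x)"
        using assms(1) by (simp add: continuous_on_def)
      from False consider "\<Phi> x < u" | "v < \<Phi> x" by linarith
      then show ?thesis
      proof cases
        case 1
        from order_tendstoD(2)[OF t this] show ?thesis
          by (rule eventually_mono) (use 1 assms(2) in \<open>simp add: rescaled_truncation_eq_0\<close>)
      next
        case 2
        from order_tendstoD(1)[OF t this] show ?thesis
          by (rule eventually_mono) (use 2 assms(2) in \<open>simp add: rescaled_truncation_eq_1\<close>)
      qed
    qed
    then have "\<forall>\<^sub>F y in at x. ennreal (\<bar>?T y - ?T x\<bar> / dist x y) = 0"
      by (rule eventually_mono) simp
    then have "Limsup (at x) (\<lambda>y. ennreal (\<bar>?T y - ?T x\<bar> / dist x y)) = Limsup (at x) (\<lambda>y. 0)"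
      by (rule Limsup_eq)
    then have "Limsup (at x) (\<lambda>y. ennreal (\<bar>?T y - ?T x\<bar> / dist x y)) = 0"
      using nontriv by (simp add: Limsup_const)
    then show ?thesis using lim by (simp add: gradient_modulus_def)
  qed
qed (simp add: gradient_modulus_def)

section \<open>Capacity of the strip between two levels\<close>

lemma Cap_mono:
  assumes "s \<le> s'"
  shows "Cap \<mu> q s b \<le> Cap \<mu> q s' b"
  unfolding Cap_def using assms by (intro Inf_superset_mono) fastforce

text \<open>
  The gradient on the right is restricted to the open strip, whose measure is controlled by the
  quantiles even if the levels \<open>t\<close> and \<open>t'\<close> have positive measure. Truncating exactly at \<open>t\<close> and \<open>t'\<close>
  would leave the gradient on these levels, so the truncation takes place at levels \<open>u\<close> and \<open>v\<close>
  with \<open>t < u < v < t'\<close>, which then tend to \<open>t\<close> and \<open>t'\<close>.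
\<close>

lemma strip_capacity:
  fixes \<mu> :: "'a::metric_space measure"
  assumes sets [measurable_cong]: "sets \<mu> = sets borel" and "finite_measure \<mu>"
    and lip: "lipschitz_on_balls \<Phi>" and "0 < q"
    and s: "s \<le> measure \<mu> {x \<in> space \<mu>. t' \<le> \<Phi> x}"
    and b: "1 - b \<le> measure \<mu> {x \<in> space \<mu>. \<Phi> x \<le> t}"
  shows "ennreal (t' - t) * Cap \<mu> q s b
    \<le> Lq_norm \<mu> q (\<lambda>x. gradient_modulus \<Phi> x * indicator {x. t < \<Phi> x \<and> \<Phi> x < t'} x)"
    (is "_ \<le> ?R")
proof (cases "t < t'")
  case True
  interpret finite_measure \<mu> by fact
  have cont: "continuous_on UNIV \<Phi>"
    using lip by (rule lipschitz_on_balls_imp_continuous)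
  have [measurable]: "\<Phi> \<in> borel_measurable borel"
    using cont by (rule borel_measurable_continuous_onI)
  have [measurable]: "gradient_modulus \<Phi> \<in> borel_measurable borel"
    using cont by (rule borel_measurable_gradient_modulus)
  have inner: "ennreal (v - u) * Cap \<mu> q s b \<le> ?R" if "t < u" "u < v" "v < t'" for u v
  proof -
    let ?\<Psi> = "\<lambda>x. rescaled_truncation u v (\<Phi> x)"
    have "s \<le> measure \<mu> {x \<in> space \<mu>. ?\<Psi> x = 1}"
      using that by (intro order_trans[OF s] finite_measure_mono)
        (auto simp: rescaled_truncation_eq_1)
    moreover have "1 - b \<le> measure \<mu> {x \<in> space \<mu>. ?\<Psi> x = 0}"
      using that by (intro order_trans[OF b] finite_measure_mono)
        (auto simp: rescaled_truncation_eq_0)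
    ultimately have "Cap \<mu> q s b \<le> Lq_norm \<mu> q (gradient_modulus ?\<Psi>)"
      unfolding Cap_def using rescaled_truncation_range
        lipschitz_on_balls_rescaled_truncation[OF lip that(2)]
      by (intro Inf_lower CollectI exI[of _ ?\<Psi>]) auto
    also have "\<dots> \<le> Lq_norm \<mu> q (\<lambda>x. ennreal (1 / (v - u)) *
        (gradient_modulus \<Phi> x * indicator {x. u \<le> \<Phi> x \<and> \<Phi> x \<le> v} x))"
      using \<open>0 < q\<close> gradient_modulus_rescaled_truncation[OF cont that(2)]
      by (intro Lq_norm_mono) auto
    also have "\<dots> = ennreal (1 / (v - u)) *
        Lq_norm \<mu> q (\<lambda>x. gradient_modulus \<Phi> x * indicator {x. u \<le> \<Phi> x \<and> \<Phi> x \<le> v} x)"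
      using \<open>0 < q\<close> by (intro Lq_norm_cmult) auto
    also have "\<dots> \<le> ennreal (1 / (v - u)) * ?R"
      using that \<open>0 < q\<close> by (intro mult_left_mono Lq_norm_mono) (auto simp: indicator_def)
    finally have "ennreal (v - u) * Cap \<mu> q s b \<le> ennreal (v - u) * (ennreal (1 / (v - u)) * ?R)"
      by (intro mult_left_mono) auto
    also have "\<dots> = ?R"
      using that by (simp add: mult.assoc[symmetric] flip: ennreal_mult)
    finally show ?thesis .
  qed
  show ?thesis
  proof (rule ennreal_le_mult_one_interval)
    fix r :: real assume r: "0 < r" "r < 1"
    let ?e = "(t' - t) * (1 - r) / 2"
    have e: "0 < ?e" using True r by auto
    have w: "(t' - ?e) - (t + ?e) = r * (t' - t)" by (simp add: field_simps)
    have "0 < r * (t' - t)" using True r by simp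
    then have "ennreal ((t' - ?e) - (t + ?e)) * Cap \<mu> q s b \<le> ?R"
      using w e by (intro inner) linarith+
    then show "ennreal r * (ennreal (t' - t) * Cap \<mu> q s b) \<le> ?R"
      using w True r by (simp add: ennreal_mult mult.assoc)
  qed
qed (simp add: ennreal_neg)

text \<open>
  Hoelder's inequality against the indicator of \<open>S\<close>.
\<close>

lemma Lq_norm_indicator_le:
  assumes "0 < r" "r < q"
    and [measurable]: "f \<in> borel_measurable M" "S \<in> sets M"
  shows "Lq_norm M r (\<lambda>x. f x * indicator S x)
    \<le> Lq_norm M q (\<lambda>x. f x * indicator S x) * epowr (emeasure M S) (1 / r - 1 / q)"
proof -
  have \<theta>: "0 < r / q" "r / q < 1" using assms by auto
  have "(\<integral>\<^sup>+x. epowr (f x * indicator S x) r \<partial>M)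
      = (\<integral>\<^sup>+x. epowr (epowr (f x * indicator S x) q) (r / q) * epowr (indicator S x) (1 - r / q) \<partial>M)"
    using assms(1,2) by (intro nn_integral_cong) (auto simp: epowr_epowr indicator_def)
  also have "\<dots> \<le> epowr (\<integral>\<^sup>+x. epowr (f x * indicator S x) q \<partial>M) (r / q)
      * epowr (emeasure M S) (1 - r / q)"
    using Holder_nn_integral[OF \<theta>, of "\<lambda>x. epowr (f x * indicator S x) q" M "indicator S"] by simp
  finally have "Lq_norm M r (\<lambda>x. f x * indicator S x)
      \<le> epowr (epowr (\<integral>\<^sup>+x. epowr (f x * indicator S x) q \<partial>M) (r / q)
          * epowr (emeasure M S) (1 - r / q)) (1 / r)"
    unfolding Lq_norm_def using assms(1) by (intro epowr_mono) auto
  also have "\<dots> = Lq_norm M q (\<lambda>x. f x * indicator S x) * epowr (emeasure M S) (1 / r - 1 / q)"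
    unfolding Lq_norm_def using assms(1,2) by (simp add: epowr_mult epowr_epowr field_simps)
  finally show ?thesis .
qed

section \<open>Slicing at geometric quantiles\<close>

text \<open>
  The supremum of the levels \<open>t\<close> with \<open>prob {f \<ge> t} \<ge> c\<close> works, because \<open>prob {f \<ge> t}\<close> is continuous
  from the left in \<open>t\<close> and its limit from the right is \<open>prob {f > t}\<close>. If \<open>f\<close> has an atom at this
  level, both inequalities may be strict.
\<close>

lemma (in prob_space) quantile_exists:
  fixes f :: "'a \<Rightarrow> real"
  assumes [measurable]: "f \<in> borel_measurable M" and range: "\<And>x. f x \<in> {0..1}"
    and c: "0 < c" "c < 1"
  shows "\<exists>t\<in>{0..1}. c \<le> prob {x \<in> space M. t \<le> f x} \<and> prob {x \<in> space M. t < f x} \<le> c"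
proof -
  define A where "A = {t. c \<le> prob {x \<in> space M. t \<le> f x}}"
  define T where "T = Sup A"
  have "{x \<in> space M. 0 \<le> f x} = space M" using range by auto
  then have A0: "0 \<in> A" using c by (simp add: A_def prob_space)
  have A1: "t \<le> 1" if "t \<in> A" for t
  proof (rule ccontr)
    assume "\<not> t \<le> 1"
    then have "f x < t" for x using range[of x] by auto
    then have "{x \<in> space M. t \<le> f x} = {}" by (auto simp: not_le)
    then have "prob {x \<in> space M. t \<le> f x} = 0" by (simp only: measure_empty)
    with that c show False unfolding A_def mem_Collect_eq by linarith
  qed
  have bdd: "bdd_above A" using A1 by (auto simp: bdd_above_def)
  have down: "t \<in> A" if "t < T" for t
  proof -
    obtain u where "u \<in> A" "t < u"
      using \<open>t < T\<close> A0 less_cSupD[of A t] unfolding T_def by auto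
    have "c \<le> prob {x \<in> space M. u \<le> f x}" using \<open>u \<in> A\<close> by (simp add: A_def)
    also have "\<dots> \<le> prob {x \<in> space M. t \<le> f x}"
      using \<open>t < u\<close> by (intro finite_measure_mono) auto
    finally show ?thesis by (simp add: A_def)
  qed
  have step: "1 / real (Suc (Suc n)) \<le> 1 / real (Suc n)" for n
    by (intro divide_left_mono) auto
  have "c \<le> prob {x \<in> space M. T \<le> f x}"
  proof -
    let ?B = "\<lambda>n. {x \<in> space M. T - 1 / real (Suc n) \<le> f x}"
    have "decseq ?B"
    proof (intro decseq_SucI subsetI)
      fix n x assume "x \<in> ?B (Suc n)"
      then show "x \<in> ?B n" using step[of n] by (simp del: of_nat_Suc)
    qed
    then have "(\<lambda>n. prob (?B n)) \<longlonglongrightarrow> prob (\<Inter>n. ?B n)"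
      by (intro finite_Lim_measure_decseq) auto
    moreover have "(\<Inter>n. ?B n) = {x \<in> space M. T \<le> f x}"
    proof -
      have "T \<le> f x" if "\<And>n. T - 1 / real (Suc n) \<le> f x" for x
      proof (rule field_le_epsilon)
        fix e :: real assume "0 < e"
        then obtain n where "1 / real (Suc n) < e" by (rule nat_approx_posE)
        then show "T \<le> f x + e" using that[of n] by linarith
      qed
      moreover have "T - 1 / real (Suc n) \<le> f x" if "T \<le> f x" for x n
        using that by (rule order_trans[rotated]) simp
      ultimately show ?thesis by blast
    qed
    moreover have "c \<le> prob (?B n)" for n
      using down[of "T - 1 / real (Suc n)"] by (simp add: A_def)
    ultimately show ?thesis by (auto intro: LIMSEQ_le_const)
  qed
  moreover have "prob {x \<in> space M. T < f x} \<le> c"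
  proof -
    let ?B = "\<lambda>n. {x \<in> space M. T + 1 / real (Suc n) \<le> f x}"
    have "incseq ?B"
    proof (intro incseq_SucI subsetI)
      fix n x assume "x \<in> ?B n"
      then show "x \<in> ?B (Suc n)" using step[of n] by (simp del: of_nat_Suc)
    qed
    then have "(\<lambda>n. prob (?B n)) \<longlonglongrightarrow> prob (\<Union>n. ?B n)"
      by (intro finite_Lim_measure_incseq) auto
    moreover have "(\<Union>n. ?B n) = {x \<in> space M. T < f x}"
    proof -
      have "\<exists>n. T + 1 / real (Suc n) \<le> f x" if "T < f x" for x
      proof -
        obtain n where "1 / real (Suc n) < f x - T"
          using nat_approx_posE[of "f x - T"] \<open>T < f x\<close> by auto
        then show ?thesis by (intro exI[of _ n]) linarith
      qed
      moreover have "T < f x" if "T + 1 / real (Suc n) \<le> f x" for x n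
        by (rule less_le_trans[OF _ that]) simp
      ultimately show ?thesis by blast
    qed
    moreover have "prob (?B n) \<le> c" for n
    proof (rule ccontr)
      assume "\<not> prob (?B n) \<le> c"
      then have "T + 1 / real (Suc n) \<in> A" by (simp add: A_def)
      then have "T + 1 / real (Suc n) \<le> T" unfolding T_def using bdd by (rule cSup_upper)
      then show False by (simp add: field_simps)
    qed
    ultimately show ?thesis by (auto intro: LIMSEQ_le_const2)
  qed
  moreover have "T \<in> {0..1}"
    unfolding T_def using A0 A1 bdd by (auto intro: cSup_upper cSup_least)
  ultimately show ?thesis by blast
qed

text \<open>
  The factor lost by slicing with ratio \<open>\<rho>\<close>. For \<open>0 < \<alpha> < 1\<close> it is least at \<open>\<rho> = 1 - \<alpha>\<close>, where
  its logarithm is the binary entropy of \<open>\<alpha>\<close>.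
\<close>

definition slicing_const :: "real \<Rightarrow> real \<Rightarrow> real"
  where "slicing_const \<alpha> \<rho> = 1 / (\<rho> powr (1 - \<alpha>) * (1 - \<rho>) powr \<alpha>)"

text \<open>
  With \<open>w = s\<^sub>i - a\<close> and \<open>s\<^sub>i = a + (b - a) \<rho>^i\<close>, this compares the Hoelder factor of the slice
  \<open>(s\<^sub>i\<^sub>+\<^sub>1, s\<^sub>i)\<close> with the weight \<open>1 / (s\<^sub>i\<^sub>+\<^sub>1 - a) powr \<alpha>\<close> times the length of the next slice. The
  constant does not depend on \<open>i\<close>, which is the reason for geometric slices.
\<close>

lemma slicing_const_identity:
  assumes "0 < \<rho>" "\<rho> < 1" "0 < w"
  shows "(w - w * \<rho>) powr (1 - \<alpha>)
    = slicing_const \<alpha> \<rho> * (w * \<rho> - w * \<rho> * \<rho>) / (w * \<rho>) powr \<alpha>"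
proof -
  have 1: "w - w * \<rho> = w * (1 - \<rho>)" "w * \<rho> - w * \<rho> * \<rho> = w * (\<rho> * (1 - \<rho>))"
    by (simp_all add: algebra_simps)
  show ?thesis
    unfolding 1 slicing_const_def using assms by (simp add: powr_mult powr_diff)
qed

text \<open>
  The estimate for one admissible \<open>\<Phi>\<close> and one ratio \<open>\<rho>\<close>. The capacity on the \<open>i\<close>-th strip is taken at
  the smaller endpoint \<open>s\<^sub>i\<^sub>+\<^sub>1\<close>, and since the integrand \<open>f\<close> decreases, its value there has to be
  compared with the integral over the following slice \<open>(s\<^sub>i\<^sub>+\<^sub>2, s\<^sub>i\<^sub>+\<^sub>1)\<close>.
\<close>

lemma capacity_slicing:
  fixes \<mu> :: "'a::metric_space measure" and \<Phi> :: "'a \<Rightarrow> real"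
    and a b p q q\<^sub>0 \<alpha> \<rho> :: real
  defines "g \<equiv> gradient_modulus \<Phi>"
  defines "f \<equiv> \<lambda>s. 1 / (ennreal ((s - a) powr \<alpha>) * epowr (Cap \<mu> q\<^sub>0 s b) p)"
  assumes sets [measurable_cong]: "sets \<mu> = sets borel" and "prob_space \<mu>"
    and lip: "lipschitz_on_balls \<Phi>" and range: "range \<Phi> \<subseteq> {0..1}"
    and one: "a \<le> measure \<mu> {x \<in> space \<mu>. \<Phi> x = 1}"
    and zero: "1 - b \<le> measure \<mu> {x \<in> space \<mu>. \<Phi> x = 0}"
    and ab: "0 < a" "a < b" "b < 1"
    and q: "1 \<le> q\<^sub>0" "q\<^sub>0 < q" and p: "1 < p" "1 / p + 1 / q = 1"
    and \<alpha>: "0 \<le> \<alpha>" "(1 - \<alpha>) / p = 1 / q\<^sub>0 - 1 / q"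
    and \<rho>: "0 < \<rho>" "\<rho> < 1"
    and nz: "Cap \<mu> q a b \<noteq> 0"
    and fin: "Lq_norm \<mu> q g \<noteq> \<top>" "(\<integral>\<^sup>+s\<in>{a<..<b}. f s \<partial>lborel) \<noteq> \<top>"
  shows "1 \<le> epowr (ennreal (slicing_const \<alpha> \<rho>)
      * (\<integral>\<^sup>+s\<in>{a<..<b}. f s \<partial>lborel)) (1 / p) * Lq_norm \<mu> q g"
proof -
  interpret prob_space \<mu> by fact
  have cont: "continuous_on UNIV \<Phi>"
    using lip by (rule lipschitz_on_balls_imp_continuous)
  have [measurable]: "\<Phi> \<in> borel_measurable borel"
    using cont by (rule borel_measurable_continuous_onI)
  have [measurable]: "g \<in> borel_measurable borel"
    unfolding g_def using cont by (rule borel_measurable_gradient_modulus)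
  have range': "\<Phi> x \<in> {0..1}" for x using range by (rule subsetD) (rule rangeI)
  define K where "K = slicing_const \<alpha> \<rho>"
  have K: "0 < K" using \<rho> by (simp add: K_def slicing_const_def)
  define I where "I = (\<integral>\<^sup>+s\<in>{a<..<b}. f s \<partial>lborel)"
  define s where "s i = a + (b - a) * \<rho> ^ i" for i
  have s0: "s 0 = b" by (simp add: s_def)
  have s_gt: "a < s i" for i using ab \<rho> by (simp add: s_def)
  have s_Suc: "s (Suc i) < s i" for i using ab \<rho> by (simp add: s_def)
  have s_anti: "s j < s i" if "i < j" for i j
    using lift_Suc_mono_less[of "\<lambda>i. - s i", OF _ that] s_Suc by simp
  have s_le: "s i \<le> b" for i using s_anti[of 0 i] s0 by (cases i) auto

  \<comment> \<open>The level 0 is prescribed for \<open>i = 0\<close> so that the telescoping sum of the strips starts at 0;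
    that it is a quantile for \<open>s 0 = b\<close> is the condition on \<open>\<mu>{\<Phi> = 0}\<close>.\<close>
  have "\<exists>\<tau>\<in>{0..1}. s i \<le> prob {x \<in> space \<mu>. \<tau> \<le> \<Phi> x} \<and> prob {x \<in> space \<mu>. \<tau> < \<Phi> x} \<le> s i
      \<and> (i = 0 \<longrightarrow> \<tau> = 0)" for i
  proof (cases i)
    case 0
    have "{x \<in> space \<mu>. 0 \<le> \<Phi> x} = space \<mu>" using range' by auto
    moreover have "prob {x \<in> space \<mu>. 0 < \<Phi> x} = 1 - prob {x \<in> space \<mu>. \<Phi> x = 0}"
    proof -
      have "{x \<in> space \<mu>. 0 < \<Phi> x} = space \<mu> - {x \<in> space \<mu>. \<Phi> x = 0}"
        using range' by (auto simp: less_le)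
      then show ?thesis by (simp add: prob_compl)
    qed
    ultimately show ?thesis using 0 s0 ab zero by (intro bexI[of _ 0]) (auto simp: prob_space)
  next
    case (Suc j)
    have "0 < s i" "s i < 1" using s_gt[of i] s_le[of i] ab by auto
    then show ?thesis
      using quantile_exists[of \<Phi> "s i"] range' Suc by simp
  qed
  then have "\<exists>t. \<forall>i. t i \<in> {0..1} \<and> s i \<le> prob {x \<in> space \<mu>. t i \<le> \<Phi> x}
      \<and> prob {x \<in> space \<mu>. t i < \<Phi> x} \<le> s i \<and> (i = 0 \<longrightarrow> t i = 0)"
    by (intro choice) blast
  then obtain t where t: "\<And>i. t i \<in> {0..1}" "\<And>i. s i \<le> prob {x \<in> space \<mu>. t i \<le> \<Phi> x}"
      "\<And>i. prob {x \<in> space \<mu>. t i < \<Phi> x} \<le> s i" and t0: "t 0 = 0"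
    by blast
  have t_Suc: "t i \<le> t (Suc i)" for i
  proof (rule ccontr)
    assume *: "\<not> t i \<le> t (Suc i)"
    have "s i \<le> prob {x \<in> space \<mu>. t i \<le> \<Phi> x}" by (rule t)
    also have "\<dots> \<le> prob {x \<in> space \<mu>. t (Suc i) < \<Phi> x}"
      using * by (intro finite_measure_mono) auto
    also have "\<dots> \<le> s (Suc i)" by (rule t)
    finally show False using s_Suc[of i] by simp
  qed
  have t_mono: "t i \<le> t j" if "i \<le> j" for i j
    using t_Suc that by (rule lift_Suc_mono_le)
  have below: "1 - b \<le> prob {x \<in> space \<mu>. \<Phi> x \<le> \<tau>}" if "0 \<le> \<tau>" for \<tau>
    using that by (intro order_trans[OF zero] finite_measure_mono) auto

  define S where "S i = {x. t i < \<Phi> x \<and> \<Phi> x < t (Suc i)}" for i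
  have [measurable]: "S i \<in> sets borel" for i unfolding S_def by measurable
  have S_disj: "disjoint_family_on S A" for A
  proof -
    have "S i \<inter> S j = {}" if "i < j" for i j
      using t_mono[of "Suc i" j] that by (auto simp: S_def)
    then show ?thesis
      unfolding disjoint_family_on_def by (metis inf_commute linorder_neqE_nat)
  qed
  have S_meas: "emeasure \<mu> (S i) \<le> ennreal (s i - s (Suc i))" for i
  proof (cases "t i = t (Suc i)")
    case True
    then have "S i = {}" by (auto simp: S_def)
    then show ?thesis by simp
  next
    case False
    then have lt: "t i < t (Suc i)" using t_Suc[of i] by simp
    have eq: "S i = {x \<in> space \<mu>. t i < \<Phi> x} - {x \<in> space \<mu>. t (Suc i) \<le> \<Phi> x}"
      using sets_eq_imp_space_eq[OF sets] by (auto simp: S_def)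
    have "prob (S i) = prob {x \<in> space \<mu>. t i < \<Phi> x} - prob {x \<in> space \<mu>. t (Suc i) \<le> \<Phi> x}"
      unfolding eq using lt by (intro finite_measure_Diff) auto
    also have "\<dots> \<le> s i - s (Suc i)" using t(2)[of "Suc i"] t(3)[of i] by linarith
    finally show ?thesis by (simp add: emeasure_eq_measure ennreal_leI)
  qed
  define n where "n i = (\<integral>\<^sup>+x. epowr (g x * indicator (S i) x) q \<partial>\<mu>)" for i
  have n_sum: "(\<Sum>i<k. n i) \<le> epowr (Lq_norm \<mu> q g) q" for k
  proof -
    have "(\<Sum>i<k. n i) = (\<integral>\<^sup>+x. (\<Sum>i<k. epowr (g x) q * indicator (S i) x) \<partial>\<mu>)"
      unfolding n_def epowr_indicator by (subst nn_integral_sum) auto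
    also have "\<dots> = (\<integral>\<^sup>+x. epowr (g x) q * (\<Sum>i<k. indicator (S i) x) \<partial>\<mu>)"
      by (simp only: sum_distrib_left)
    also have "\<dots> \<le> (\<integral>\<^sup>+x. epowr (g x) q * 1 \<partial>\<mu>)"
      by (intro nn_integral_mono mult_left_mono sum_indicator_disjoint_le_1 S_disj) auto
    also have "\<dots> = epowr (Lq_norm \<mu> q g) q"
      using q by (simp add: Lq_norm_def epowr_epowr)
    finally show ?thesis .
  qed
  have n_fin: "n i \<noteq> \<top>" for i
  proof -
    have "n i \<le> (\<Sum>i<Suc i. n i)" by simp
    also have "\<dots> \<le> epowr (Lq_norm \<mu> q g) q" by (rule n_sum)
    also have "\<dots> < \<top>" using fin by (simp add: less_top[symmetric])
    finally show ?thesis by simp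
  qed

  have f_anti: "f v \<le> f u" if "a < u" "u \<le> v" for u v
    unfolding f_def using that \<alpha> p
    by (intro one_divide_antimono_ennreal mult_mono epowr_mono Cap_mono ennreal_leI powr_mono2) auto
  have f_sum: "(\<Sum>i<k. f (s (Suc i)) * ennreal (s (Suc i) - s (Suc (Suc i)))) \<le> I" for k
  proof -
    let ?J = "\<lambda>i. {s (Suc (Suc i))<..<s (Suc i)}"
    have disj: "disjoint_family_on ?J {..<k}"
    proof -
      have "?J i \<inter> ?J j = {}" if "i < j" for i j
      proof -
        have "s (Suc j) \<le> s (Suc (Suc i))"
          using s_anti[of "Suc (Suc i)" "Suc j"] that by (cases "j = Suc i") auto
        then show ?thesis by auto
      qed
      then show ?thesis
        unfolding disjoint_family_on_def by (metis inf_commute linorder_neqE_nat)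
    qed
    have "(\<Sum>i<k. f (s (Suc i)) * ennreal (s (Suc i) - s (Suc (Suc i))))
        = (\<Sum>i<k. f (s (Suc i)) * emeasure lborel (?J i))"
      using s_Suc by (intro sum.cong) (auto simp: less_imp_le)
    also have "\<dots> = (\<integral>\<^sup>+u. (\<Sum>i<k. f (s (Suc i)) * indicator (?J i) u) \<partial>lborel)"
      by (subst nn_integral_sum) (auto simp: nn_integral_cmult_indicator)
    also have "\<dots> \<le> (\<integral>\<^sup>+u. (\<Sum>i<k. (f u * indicator {a<..<b} u) * indicator (?J i) u) \<partial>lborel)"
    proof (intro nn_integral_mono sum_mono)
      fix u i
      show "f (s (Suc i)) * indicator (?J i) u \<le> f u * indicator {a<..<b} u * indicator (?J i) u"
        using f_anti[of u "s (Suc i)"] s_gt[of "Suc (Suc i)"] s_le[of "Suc i"]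
        by (auto simp: indicator_def)
    qed
    also have "\<dots> = (\<integral>\<^sup>+u. (f u * indicator {a<..<b} u) * (\<Sum>i<k. indicator (?J i) u) \<partial>lborel)"
      by (simp only: sum_distrib_left)
    also have "\<dots> \<le> (\<integral>\<^sup>+u. (f u * indicator {a<..<b} u) * 1 \<partial>lborel)"
      by (intro nn_integral_mono mult_left_mono sum_indicator_disjoint_le_1 disj) auto
    finally show ?thesis by (simp add: I_def)
  qed
  \<comment> \<open>A zero of the capacity at \<open>s (Suc i)\<close> would make the integrand infinite on the slice below it.\<close>
  have Cap_nz: "Cap \<mu> q\<^sub>0 (s (Suc i)) b \<noteq> 0" for i
  proof
    assume "Cap \<mu> q\<^sub>0 (s (Suc i)) b = 0"
    then have "f (s (Suc i)) = \<top>" by (simp add: f_def)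
    moreover have "f (s (Suc i)) * ennreal (s (Suc i) - s (Suc (Suc i))) \<le> I"
      by (rule order_trans[OF _ f_sum[of "Suc i"]]) simp
    ultimately show False
      using fin(2) s_Suc[of "Suc i"] by (simp add: I_def ennreal_top_mult top_unique)
  qed

  have strip: "ennreal (t (Suc i) - t i)
      \<le> epowr (K * (f (s (Suc i)) * ennreal (s (Suc i) - s (Suc (Suc i))))) (1 / p)
        * epowr (n i) (1 - 1 / p)" for i
  proof -
    let ?C = "Cap \<mu> q\<^sub>0 (s (Suc i)) b"
    let ?\<delta> = "s i - s (Suc i)"
    let ?A = "(s (Suc i) - a) powr \<alpha>"
    let ?l = "s (Suc i) - s (Suc (Suc i))"
    have qp: "1 / q = 1 - 1 / p" using p by simp
    have pos: "0 < ?\<delta>" "0 < ?l" "0 < ?A" using s_Suc s_gt[of "Suc i"] by auto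
    have "ennreal (t (Suc i) - t i) * ?C \<le> Lq_norm \<mu> q\<^sub>0 (\<lambda>x. g x * indicator (S i) x)"
      unfolding g_def S_def using q t(1)[of i] t(2)
      by (intro strip_capacity sets lip below finite_measure_axioms) auto
    also have "\<dots> \<le> Lq_norm \<mu> q (\<lambda>x. g x * indicator (S i) x)
        * epowr (emeasure \<mu> (S i)) (1 / q\<^sub>0 - 1 / q)"
      using q by (intro Lq_norm_indicator_le) auto
    also have "\<dots> \<le> epowr (n i) (1 / q) * epowr (ennreal ?\<delta>) ((1 - \<alpha>) / p)"
      unfolding Lq_norm_def n_def \<alpha>(2) using q S_meas
      by (intro mult_left_mono epowr_mono) (auto simp: field_simps)
    finally have "ennreal (t (Suc i) - t i)
        \<le> epowr (n i) (1 / q) * epowr (ennreal ?\<delta>) ((1 - \<alpha>) / p) * (1 / ?C)"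
      using Cap_nz n_fin by (intro ennreal_le_mult_inverseI) (auto simp: ennreal_mult_eq_top_iff)
    also have "epowr (ennreal ?\<delta>) ((1 - \<alpha>) / p) = epowr (ennreal (?\<delta> powr (1 - \<alpha>))) (1 / p)"
      using pos by (simp add: epowr_ennreal powr_powr)
    also have "?\<delta> powr (1 - \<alpha>) = K * ?l / ?A"
    proof -
      let ?w = "(b - a) * \<rho> ^ i"
      have w: "0 < ?w" using ab \<rho> by simp
      have "s i = a + ?w" "s (Suc i) = a + ?w * \<rho>" "s (Suc (Suc i)) = a + ?w * \<rho> * \<rho>"
        by (simp_all add: s_def)
      then show ?thesis
        using slicing_const_identity[OF \<rho> w, of \<alpha>] unfolding K_def by simp
    qed
    also have "epowr (n i) (1 / q) * epowr (ennreal (K * ?l / ?A)) (1 / p) * (1 / ?C)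
        = epowr (n i) (1 / q) * epowr (ennreal (K * ?l / ?A) * (1 / epowr ?C p)) (1 / p)"
    proof -
      have "epowr (1 / epowr ?C p) (1 / p) = 1 / ?C"
        using p by (simp add: epowr_divide epowr_epowr)
      then show ?thesis using p by (simp add: epowr_mult mult.assoc)
    qed
    also have "ennreal (K * ?l / ?A) * (1 / epowr ?C p) = K * (f (s (Suc i)) * ennreal ?l)"
    proof -
      have "f (s (Suc i)) = inverse (ennreal ?A) * (1 / epowr ?C p)"
        using pos Cap_nz[of i] unfolding f_def divide_ennreal_def
        by (subst ennreal_inverse_mult') (auto simp: zero_less_iff_neq_zero)
      moreover have "ennreal (K * ?l / ?A) = ennreal K * ennreal ?l * inverse (ennreal ?A)"
        using pos K by (simp add: inverse_ennreal divide_inverse flip: ennreal_mult)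
      ultimately show ?thesis by (simp add: ac_simps)
    qed
    finally show ?thesis unfolding qp by (simp add: mult.commute)
  qed

  let ?R = "epowr (ennreal K * I) (1 / p) * Lq_norm \<mu> q g"
  have sum: "ennreal (t k) \<le> ?R" for k
  proof -
    let ?x = "\<lambda>i. K * (f (s (Suc i)) * ennreal (s (Suc i) - s (Suc (Suc i))))"
    have "ennreal (t k) = ennreal (\<Sum>i<k. t (Suc i) - t i)"
      by (simp add: sum_lessThan_telescope t0)
    also have "\<dots> = (\<Sum>i<k. ennreal (t (Suc i) - t i))"
      using t_Suc by (intro sum_ennreal[symmetric]) auto
    also have "\<dots> \<le> (\<Sum>i<k. epowr (?x i) (1 / p) * epowr (n i) (1 - 1 / p))"
      by (intro sum_mono strip)
    also have "\<dots> \<le> epowr (\<Sum>i<k. ?x i) (1 / p) * epowr (\<Sum>i<k. n i) (1 - 1 / p)"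
      using p by (intro Holder_sum) auto
    also have "\<dots> \<le> epowr (ennreal K * I) (1 / p) * epowr (epowr (Lq_norm \<mu> q g) q) (1 - 1 / p)"
      using p n_sum f_sum
      by (intro mult_mono epowr_mono) (auto simp: mult_left_mono simp flip: sum_distrib_left)
    also have "epowr (epowr (Lq_norm \<mu> q g) q) (1 - 1 / p) = Lq_norm \<mu> q g"
    proof -
      have "q * (1 - 1 / p) = 1" using p q by (simp add: field_simps)
      then show ?thesis by (simp add: epowr_epowr)
    qed
    finally show ?thesis .
  qed
  have "1 \<le> ?R"
  proof (rule ennreal_le_mult_one_interval)
    fix r :: real assume r: "0 < r" "r < 1"
    \<comment> \<open>Otherwise \<open>\<mu>{\<Phi> > r} \<le> a \<le> \<mu>{\<Phi> = 1}\<close>, so almost no mass lies strictly between the levels \<open>r\<close> and 1,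
      and truncations to levels between them have gradient 0 almost everywhere: the capacity would be 0.\<close>
    have "\<exists>k. r < t k"
    proof (rule ccontr)
      assume "\<not> (\<exists>k. r < t k)"
      then have le: "t k \<le> r" for k by (auto simp: not_less)
      let ?G = "{x. r < \<Phi> x \<and> \<Phi> x < 1}"
      have "prob {x \<in> space \<mu>. r < \<Phi> x} \<le> s k" for k
        using le[of k] by (intro order_trans[OF _ t(3)[of k]] finite_measure_mono) auto
      moreover have "s \<longlonglongrightarrow> a"
        using \<rho> unfolding s_def[abs_def] by (auto intro!: tendsto_eq_intros LIMSEQ_power_zero)
      ultimately have "prob {x \<in> space \<mu>. r < \<Phi> x} \<le> a"
        by (auto intro: LIMSEQ_le_const)
      moreover have eq: "?G = {x \<in> space \<mu>. r < \<Phi> x} - {x \<in> space \<mu>. \<Phi> x = 1}"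
        using sets_eq_imp_space_eq[OF sets] range' by (auto simp: less_le)
      have "prob ?G = prob {x \<in> space \<mu>. r < \<Phi> x} - prob {x \<in> space \<mu>. \<Phi> x = 1}"
        unfolding eq using r by (intro finite_measure_Diff) auto
      ultimately have "prob ?G = 0" using one measure_nonneg[of \<mu> ?G] by linarith
      then have null: "?G \<in> null_sets \<mu>"
        by (intro null_setsI) (auto simp: emeasure_eq_measure)
      have one': "a \<le> prob {x \<in> space \<mu>. 1 \<le> \<Phi> x}"
        by (rule order_trans[OF one finite_measure_mono]) auto
      have "ennreal (1 - r) * Cap \<mu> q a b \<le> Lq_norm \<mu> q (\<lambda>x. g x * indicator ?G x)"
        unfolding g_def using q r one'
        by (intro strip_capacity sets lip below finite_measure_axioms) auto
      also have "\<dots> = 0"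
      proof -
        have "AE x in \<mu>. epowr (g x * indicator ?G x) q = 0"
          using AE_not_in[OF null] by eventually_elim auto
        then show ?thesis by (simp add: Lq_norm_def nn_integral_0_iff_AE)
      qed
      finally show False using nz r by simp
    qed
    then obtain k where "r < t k" ..
    then have "ennreal r \<le> ennreal (t k)" by (simp add: ennreal_leI)
    with sum[of k] show "ennreal r * 1 \<le> ?R" by simp
  qed
  then show ?thesis by (simp add: K_def I_def)
qed

section \<open>Optimising the ratio of the slices\<close>

lemma conj_exponent_real: "1 < q \<Longrightarrow> conj_exponent (ereal q) = ereal (q / (q - 1))"
  by (simp add: conj_exponent_def one_ereal_def)

text \<open>
  Both sides are the \<open>p\<close>-th root of \<open>1 / (\<alpha> powr \<alpha> * (1 - \<alpha>) powr (1 - \<alpha>))\<close> with \<open>\<alpha> = p / p\<^sub>0\<close>.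
\<close>

lemma gamma_const_eq_slicing_const:
  assumes "0 < p" "p < p\<^sub>0"
  shows "gamma_const (ereal p) (ereal p\<^sub>0) = slicing_const (p / p\<^sub>0) (1 - p / p\<^sub>0) powr (1 / p)"
proof -
  define \<alpha> where "\<alpha> = p / p\<^sub>0"
  have \<alpha>: "0 < \<alpha>" "\<alpha> < 1" using assms by (auto simp: \<alpha>_def)
  have 1: "p\<^sub>0 / p = 1 / \<alpha>" "1 / p\<^sub>0 = \<alpha> / p" using assms by (auto simp: \<alpha>_def)
  have "gamma_const (ereal p) (ereal p\<^sub>0) = (p\<^sub>0 / p - 1) powr (1 / p\<^sub>0) / (1 - \<alpha>) powr (1 / p)"
    using assms by (simp add: gamma_const_def one_ereal_def \<alpha>_def)
  also have "\<dots> = ((1 - \<alpha>) / \<alpha>) powr (\<alpha> / p) / (1 - \<alpha>) powr (1 / p)"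
    unfolding 1 using \<alpha> by (simp add: field_simps)
  also have "\<dots> = 1 / ((1 - \<alpha>) powr (1 / p - \<alpha> / p) * \<alpha> powr (\<alpha> / p))"
    using \<alpha> by (simp add: powr_divide powr_diff)
  also have "\<dots> = slicing_const \<alpha> (1 - \<alpha>) powr (1 / p)"
    using \<alpha> by (simp add: slicing_const_def powr_divide powr_mult powr_powr diff_divide_distrib)
  finally show ?thesis by (simp add: \<alpha>_def)
qed

text \<open>
  The factor \<open>r\<close> makes room for the case \<open>\<alpha> = 0\<close>, in which \<open>\<gamma> = 1\<close> is the infimum of
  \<open>(1 / \<rho>) powr (1 / p)\<close> over \<open>0 < \<rho> < 1\<close> and is not attained.
\<close>

lemma slicing_const_near_gamma:
  assumes p: "1 < p" and \<alpha>: "0 \<le> \<alpha>" "\<alpha> < 1"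
    and p\<^sub>0: "p\<^sub>0 = (if \<alpha> = 0 then \<infinity> else ereal (p / \<alpha>))"
    and r: "0 < r" "r < 1"
  shows "\<exists>\<rho>. 0 < \<rho> \<and> \<rho> < 1 \<and> r * slicing_const \<alpha> \<rho> powr (1 / p) \<le> gamma_const (ereal p) p\<^sub>0"
proof (cases "\<alpha> = 0")
  case True
  have "r powr p < 1" using powr_less_mono2[of p r 1] r p by simp
  moreover have "r * slicing_const \<alpha> (r powr p) powr (1 / p) = 1"
    using r p True by (simp add: slicing_const_def powr_divide powr_powr)
  ultimately show ?thesis
    using True r p\<^sub>0 by (intro exI[of _ "r powr p"]) (simp add: gamma_const_def)
next
  case False
  then have pos: "0 < \<alpha>" using \<alpha> by simp
  have "gamma_const (ereal p) p\<^sub>0 = slicing_const \<alpha> (1 - \<alpha>) powr (1 / p)"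
    using gamma_const_eq_slicing_const[of p "p / \<alpha>"] p pos \<alpha> False p\<^sub>0 by (simp add: field_simps)
  then have "r * slicing_const \<alpha> (1 - \<alpha>) powr (1 / p) \<le> gamma_const (ereal p) p\<^sub>0"
    using r by (simp add: mult_left_le_one_le)
  then show ?thesis using \<alpha> pos by (intro exI[of _ "1 - \<alpha>"]) simp
qed

theorem proposition3p12:
  fixes \<mu> :: "'a::metric_space measure"
    and q\<^sub>0 q a b :: real
    and p\<^sub>0 p :: ereal
  assumes "metric_probability_space \<mu>"
    and "1 \<le> q\<^sub>0" and "q\<^sub>0 < q"
    and "p\<^sub>0 = conj_exponent (ereal q\<^sub>0)" and "p = conj_exponent (ereal q)"
    and "0 < a" and "a < b" and "b < 1"
    and "Cap \<mu> q a b \<noteq> 0"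
  shows "1 / Cap \<mu> q a b \<le>
    ennreal (gamma_const p p\<^sub>0) *
    epowr (\<integral>\<^sup>+s\<in>{a<..<b}.
             (1 / (ennreal ((s - a) powr real_of_ereal (p / p\<^sub>0)) *
                   epowr (Cap \<mu> q\<^sub>0 s b) (real_of_ereal p))) \<partial>lborel)
          (real_of_ereal (1 / p))"
proof -
  define P where "P = q / (q - 1)"
  define \<alpha> where "\<alpha> = P * (1 - 1 / q\<^sub>0)"
  have P: "1 < P" "1 / P + 1 / q = 1"
    using assms(2,3) by (auto simp: P_def field_simps)
  have p_eq: "p = ereal P"
    using assms by (simp add: conj_exponent_real P_def)
  have \<alpha>_eq: "(1 - \<alpha>) / P = 1 / q\<^sub>0 - 1 / q"
  proof -
    have "(1 - \<alpha>) / P = 1 / P - (1 - 1 / q\<^sub>0)"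
      using P by (simp add: \<alpha>_def diff_divide_distrib)
    then show ?thesis using P(2) by linarith
  qed
  have \<alpha>: "0 \<le> \<alpha>" "\<alpha> < 1"
  proof -
    show "0 \<le> \<alpha>" using P assms(2) by (simp add: \<alpha>_def)
    have "0 < (1 - \<alpha>) / P"
      unfolding \<alpha>_eq using assms(2,3) by (simp add: field_simps)
    then show "\<alpha> < 1" using P by (simp add: zero_less_divide_iff)
  qed
  have p\<^sub>0_eq: "p\<^sub>0 = (if \<alpha> = 0 then \<infinity> else ereal (P / \<alpha>))"
  proof (cases "q\<^sub>0 = 1")
    case True
    then show ?thesis using assms(4) by (simp add: conj_exponent_def one_ereal_def \<alpha>_def)
  next
    case False
    then have "1 < q\<^sub>0" using assms(2) by simp
    then have "\<alpha> \<noteq> 0" "P / \<alpha> = q\<^sub>0 / (q\<^sub>0 - 1)"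
      using P by (auto simp: \<alpha>_def field_simps)
    then show ?thesis using \<open>1 < q\<^sub>0\<close> assms(4) by (simp add: conj_exponent_real)
  qed
  have reals: "real_of_ereal p = P" "real_of_ereal (1 / p) = 1 / P" "real_of_ereal (p / p\<^sub>0) = \<alpha>"
    using P \<alpha> by (auto simp: p_eq p\<^sub>0_eq one_ereal_def)
  define I where "I = (\<integral>\<^sup>+s\<in>{a<..<b}.
    (1 / (ennreal ((s - a) powr \<alpha>) * epowr (Cap \<mu> q\<^sub>0 s b) P)) \<partial>lborel)"
  define R where "R = ennreal (gamma_const p p\<^sub>0) * epowr I (1 / P)"
  have "1 / Cap \<mu> q a b \<le> R"
  proof (cases "R = \<top>")
    case False
    \<comment> \<open>Positivity of \<open>\<gamma>\<close> makes the right-hand side infinite whenever the integral is.\<close>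
    have gamma_pos: "0 < gamma_const p p\<^sub>0"
    proof -
      obtain \<rho> where "0 < \<rho>" "\<rho> < 1" "1/2 * slicing_const \<alpha> \<rho> powr (1 / P) \<le> gamma_const p p\<^sub>0"
        using slicing_const_near_gamma[OF P(1) \<alpha> p\<^sub>0_eq, of "1/2"] p_eq by auto
      moreover from this have "0 < slicing_const \<alpha> \<rho>" by (simp add: slicing_const_def)
      ultimately show ?thesis by (smt (verit) mult_pos_pos powr_gt_zero half_gt_zero)
    qed
    then have I_fin: "I \<noteq> \<top>"
      using False by (auto simp: R_def ennreal_mult_top)
    have "1 / R \<le> Cap \<mu> q a b"
      unfolding Cap_def
    proof (rule Inf_greatest, safe)
      fix \<Phi> :: "'a \<Rightarrow> real"
      assume \<Phi>: "range \<Phi> \<subseteq> {0..1}" "lipschitz_on_balls \<Phi>"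
        "a \<le> measure \<mu> {x \<in> space \<mu>. \<Phi> x = 1}" "1 - b \<le> measure \<mu> {x \<in> space \<mu>. \<Phi> x = 0}"
      let ?N = "Lq_norm \<mu> q (gradient_modulus \<Phi>)"
      show "1 / R \<le> ?N"
      proof (cases "?N = \<top>")
        case N: False
        have "1 \<le> R * ?N"
        proof (rule ennreal_le_mult_one_interval)
          fix r :: real assume r: "0 < r" "r < 1"
          obtain \<rho> where \<rho>: "0 < \<rho>" "\<rho> < 1"
              "r * slicing_const \<alpha> \<rho> powr (1 / P) \<le> gamma_const p p\<^sub>0"
            using slicing_const_near_gamma[OF P(1) \<alpha> p\<^sub>0_eq r] p_eq by auto
          have K: "0 \<le> slicing_const \<alpha> \<rho>" using \<rho> by (simp add: slicing_const_def)
          have "1 \<le> epowr (ennreal (slicing_const \<alpha> \<rho>) * I) (1 / P) * ?N"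
            unfolding I_def using assms \<Phi> P \<alpha> \<alpha>_eq \<rho> N I_fin
            by (intro capacity_slicing) (auto simp: metric_probability_space_def I_def)
          then have "ennreal r * 1
              \<le> ennreal r * (epowr (ennreal (slicing_const \<alpha> \<rho>) * I) (1 / P) * ?N)"
            by (rule mult_left_mono) simp
          also have "\<dots> = ennreal (r * slicing_const \<alpha> \<rho> powr (1 / P)) * (epowr I (1 / P) * ?N)"
            using P r K by (simp add: epowr_mult epowr_ennreal ennreal_mult mult.assoc)
          also have "\<dots> \<le> ennreal (gamma_const p p\<^sub>0) * (epowr I (1 / P) * ?N)"
            using \<rho> by (intro mult_right_mono ennreal_leI) auto
          finally show "ennreal r * 1 \<le> R * ?N" by (simp add: R_def mult.assoc)
        qed
        then have "1 / R \<le> ?N * R / R"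
          by (intro divide_right_mono_ennreal) (simp add: mult.commute)
        moreover have "R \<noteq> 0" using \<open>1 \<le> R * ?N\<close> by auto
        ultimately show ?thesis using False by (simp add: ennreal_mult_divide_eq)
      qed simp
    qed
    then have "1 / Cap \<mu> q a b \<le> 1 / (1 / R)" by (rule one_divide_antimono_ennreal)
    then show ?thesis by simp
  qed simp
  then show ?thesis unfolding reals R_def I_def .
qed

end
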